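(* Let $p\ge -1$ be an integer and let $c>0$. For all non-negative integers $N,n,k$ such that $N+2k\ge ec$ (where $e$ is the base of the natural logarithm), $$\left|\int_0^1 \Phi_{N,n}(r)\,\overline{R}_{N,k}(r)\,r^{p+1}\,dr\right| < (p+2)^{-1/2}\,|\beta_{N,n}|^{-1}\left(\frac12\right)^{N+p/2+2k+1}.$$
   Context: Let $p\ge-1$ be an integer, $c>0$, and let $J_\nu$ be the Bessel function of the first kind. For a non-negative integer $N$ define the compact self-adjoint operator $H_{N,c}$ on $L^2([0,1],\rho^{p+1}d\rho)$ by $$H_{N,c}[\Phi](r)=\int_0^1 \frac{J_{N+p/2}(cr\rho)}{(cr\rho)^{p/2}}\,\Phi(\rho)\,\rho^{p+1}\,d\rho,\qquad 0\le r\le 1$$ (the kernel being extended by continuity where $r\rho=0$). Its eigenvalues are $\beta_{N,0},\beta_{N,1},\ldots$ with $|\beta_{N,n}|\ge|\beta_{N,n+1}|$ (they are nonzero), and $\Phi_{N,n}$ is the real-valued eigenfunction for $\beta_{N,n}$, normalized by $\int_0^1\Phi_{N,n}(r)^2r^{p+1}dr=1$ and $\Phi_{N,n}(1)>0$. The radial Zernike polynomials are $$R_{N,k}(r)=r^N\sum_{m=0}^k(-1)^m\binom{k+N+\frac p2}{m}\binom{k}{m}(r^2)^{k-m}(1-r^2)^m,$$ and $\overline R_{N,k}(r)=\sqrt{2(2k+N+p/2+1)}\,R_{N,k}(r)$, so that $\int_0^1\overline R_{N,k}(r)^2r^{p+1}dr=1$. *)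

theory Defs
  imports "HOL-Analysis.Analysis"
begin

text \<open>
  \<open>J\<^sub>\<nu>(x)\<close> by its power series, for \<open>x > 0\<close> only: the convention \<open>0 powr a = 0\<close> makes the
  value at \<open>x = 0\<close> meaningless for \<open>\<nu> \<le> 0\<close>.  Using \<open>rGamma = 1 / Gamma\<close> gives the usual vanishing
  of the coefficients at the poles of \<open>Gamma\<close>.
\<close>

definition bessel_J :: "real \<Rightarrow> real \<Rightarrow> real" where
  "bessel_J \<nu> x = (\<Sum>m. (-1) ^ m * rGamma (\<nu> + real m + 1) / fact m * (x / 2) powr (2 * real m + \<nu>))"

definition radial_measure :: "int \<Rightarrow> real measure" where
  "radial_measure p =
     density (restrict_space lborel {0..1}) (\<lambda>r. ennreal (r ^ nat (p + 1)))"

definition radial_L2 :: "int \<Rightarrow> (real \<Rightarrow> real) \<Rightarrow> bool" where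
  "radial_L2 p \<Phi> \<longleftrightarrow>
     \<Phi> \<in> borel_measurable (radial_measure p) \<and> integrable (radial_measure p) (\<lambda>r. (\<Phi> r)\<^sup>2)"

definition H_kernel :: "int \<Rightarrow> nat \<Rightarrow> real \<Rightarrow> real" where
  "H_kernel p N x =
     (let K = (\<lambda>y. bessel_J (real N + real_of_int p / 2) y / y powr (real_of_int p / 2))
      in if x > 0 then K x else Lim (at_right 0) K)"

definition H_op :: "int \<Rightarrow> real \<Rightarrow> nat \<Rightarrow> (real \<Rightarrow> real) \<Rightarrow> real \<Rightarrow> real" where
  "H_op p c N \<Phi> r = (LINT \<rho>|radial_measure p. H_kernel p N (c * r * \<rho>) * \<Phi> \<rho>)"

text \<open>
  Eigenfunctions are taken in the real Hilbert space; the kernel is real and symmetric, so the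
  eigenvalues are the same as over the complex numbers.
\<close>

definition H_eigenfunction :: "int \<Rightarrow> real \<Rightarrow> nat \<Rightarrow> real \<Rightarrow> (real \<Rightarrow> real) \<Rightarrow> bool" where
  "H_eigenfunction p c N \<mu> \<Phi> \<longleftrightarrow>
     radial_L2 p \<Phi> \<and>
     \<not> (AE r in radial_measure p. \<Phi> r = 0) \<and>
     (AE r in radial_measure p. H_op p c N \<Phi> r = \<mu> * \<Phi> r)"

text \<open>
  The eigenvalues are simple, so the enumeration is a bijection onto the set of eigenvalues.
  The eigenvalue equation is required at every point of \<open>[0,1]\<close>: it selects the continuous
  representative of the \<open>L\<^sup>2\<close> class, for which the sign condition at 1 makes sense.
\<close>

definition H_eigensystem ::
    "int \<Rightarrow> real \<Rightarrow> nat \<Rightarrow> (nat \<Rightarrow> real) \<Rightarrow> (nat \<Rightarrow> real \<Rightarrow> real) \<Rightarrow> bool" where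
  "H_eigensystem p c N \<beta> \<Phi> \<longleftrightarrow>
     bij_betw \<beta> UNIV {\<mu>. \<exists>\<Psi>. H_eigenfunction p c N \<mu> \<Psi>} \<and>
     (\<forall>n. \<bar>\<beta> n\<bar> \<ge> \<bar>\<beta> (Suc n)\<bar>) \<and>
     (\<forall>n. \<beta> n \<noteq> 0) \<and>
     (\<forall>n. H_eigenfunction p c N (\<beta> n) (\<Phi> n)) \<and>
     (\<forall>n. \<forall>r\<in>{0..1}. H_op p c N (\<Phi> n) r = \<beta> n * \<Phi> n r) \<and>
     (\<forall>n. (LINT r|radial_measure p. (\<Phi> n r)\<^sup>2) = 1) \<and>
     (\<forall>n. \<Phi> n 1 > 0)"

definition zernike_R :: "int \<Rightarrow> nat \<Rightarrow> nat \<Rightarrow> real \<Rightarrow> real" where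
  "zernike_R p N k r =
     r ^ N * (\<Sum>m=0..k. (-1) ^ m * ((real k + real N + real_of_int p / 2) gchoose m)
                          * real (k choose m) * (r\<^sup>2) ^ (k - m) * (1 - r\<^sup>2) ^ m)"

definition zernike_Rbar :: "int \<Rightarrow> nat \<Rightarrow> nat \<Rightarrow> real \<Rightarrow> real" where
  "zernike_Rbar p N k r =
     sqrt (2 * (2 * real k + real N + real_of_int p / 2 + 1)) * zernike_R p N k r"

end

theory Submission
  imports Defs
begin

text \<open>
  The operator \<open>H\<close> is symmetric, so
  \<open>\<beta> \<langle>\<Phi>, R\<rangle> = \<langle>H \<Phi>, R\<rangle> = \<langle>\<Phi>, H R\<rangle>\<close>, and the transform of a Zernike polynomial is known in closed form:
  \<open>H R\<^sub>N\<^sub>,\<^sub>k (\<rho>) = (-1)\<^sup>k J\<^sub>\<nu>(c \<rho>) / (c \<rho>) powr (p/2 + 1)\<close> with \<open>\<nu> = N + p/2 + 2k + 1\<close>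
  (\<open>zernike_hankel_transform\<close>).  A high-order Bessel function is tiny as long as its argument is well
  below the order, and this is what the hypothesis \<open>N + 2k \<ge> e c\<close> provides.

  Quantitatively, write \<open>M = N + 2k\<close>.  The bound \<open>\<bar>J\<^sub>\<nu>(x)\<bar> \<le> (x/2)\<^sup>\<nu> / \<Gamma>(\<nu> + 1)\<close>
  (\<open>abs_hyp01_le_1\<close>, a monotone energy) shows that \<open>\<bar>H R\<^sub>N\<^sub>,\<^sub>k (\<rho>)\<bar>\<close> is at most
  \<open>(1/2)\<^sup>\<nu> c\<^sup>M \<rho>\<^sup>M / \<Gamma>(\<nu> + 1)\<close>.  The norm of \<open>\<rho>\<^sup>M\<close> cancels exactly against the normalization
  of \<open>R\<close>, so the Cauchy-Schwarz inequality gives \<open>\<bar>\<beta>\<bar> \<bar>\<langle>\<Phi>, R\<rangle>\<bar> \<le> (1/2)\<^sup>\<nu> c\<^sup>M / \<Gamma>(\<nu> + 1)\<close> for the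
  normalized \<open>R\<close> (\<open>eigenfunction_zernike_bound\<close>).  Finally
  \<open>c\<^sup>M \<le> (M/e)\<^sup>M < \<Gamma>(M + p/2 + 2) / sqrt (p + 2)\<close> by a Stirling-type estimate
  (\<open>power_div_exp_less_Gamma\<close>).

  All Bessel functions appear through the entire function \<open>hyp01 b z = \<^sub>0F\<^sub>1(; b; -z)\<close>, and the
  symmetry of \<open>H\<close> is read off from the power series of the
  kernel (\<open>powser_kernel_symmetric\<close>).
\<close>

section \<open>The Bessel kernel as an entire function\<close>

text \<open>
  The Taylor coefficients of \<open>\<^sub>0F\<^sub>1(; b; -z)\<close>.  Up to a constant, \<open>J\<^sub>\<nu>(x)\<close> is
  \<open>x\<^sup>\<nu> \<^sub>0F\<^sub>1(; \<nu> + 1; -x\<^sup>2/4)\<close>; in the variable \<open>z = x\<^sup>2/4\<close> the fractional power and the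
  singularity of Bessel's equation at the origin disappear.
\<close>
definition hyp01_coeff :: "real \<Rightarrow> nat \<Rightarrow> real" where
  "hyp01_coeff b l = (-1) ^ l / (fact l * pochhammer b l)"

definition hyp01 :: "real \<Rightarrow> real \<Rightarrow> real" where
  "hyp01 b z = (\<Sum>l. hyp01_coeff b l * z ^ l)"

lemma hyp01_coeff_Suc:
  assumes "b > 0"
  shows "hyp01_coeff b (Suc l) * ((real l + 1) * (b + real l)) = - hyp01_coeff b l"
proof -
  have "b + real l \<noteq> 0" "real l + 1 \<noteq> 0" "pochhammer b l \<noteq> 0"
    using assms pochhammer_pos[of b l] by linarith+
  then show ?thesis
    by (simp add: hyp01_coeff_def pochhammer_rec' add.commute[of 1] divide_simps)
qed

lemma summable_abs_hyp01:
  assumes "b > 0"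
  shows "summable (\<lambda>l. \<bar>hyp01_coeff b l * z ^ l\<bar>)"
proof (rule summable_ratio_test[where c = "1/2" and N = "nat \<lceil>2 * \<bar>z\<bar>\<rceil> + 1"])
  fix l assume l: "l \<ge> nat \<lceil>2 * \<bar>z\<bar>\<rceil> + 1"
  define q where "q = (real l + 1) * (b + real l)"
  have "2 * \<bar>z\<bar> \<le> real l" "1 \<le> real l" using l by linarith+
  then have "2 * \<bar>z\<bar> * 1 \<le> q"
    unfolding q_def using assms by (intro mult_mono) auto
  moreover have "q > 0" using assms \<open>1 \<le> real l\<close> by (simp add: q_def)
  ultimately have *: "\<bar>z\<bar> / q \<le> 1 / 2" by (simp add: field_simps)
  have "hyp01_coeff b (Suc l) = - hyp01_coeff b l / q"
    using hyp01_coeff_Suc[OF assms, of l, folded q_def] \<open>q > 0\<close> by (simp add: field_simps)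
  then have "\<bar>hyp01_coeff b (Suc l) * z ^ Suc l\<bar> = \<bar>z\<bar> / q * \<bar>hyp01_coeff b l * z ^ l\<bar>"
    using \<open>q > 0\<close> by (simp add: abs_mult)
  also have "\<dots> \<le> 1 / 2 * \<bar>hyp01_coeff b l * z ^ l\<bar>"
    by (intro mult_right_mono *) auto
  finally show "norm \<bar>hyp01_coeff b (Suc l) * z ^ Suc l\<bar> \<le> 1 / 2 * norm \<bar>hyp01_coeff b l * z ^ l\<bar>"
    by simp
qed simp

lemma summable_hyp01: "b > 0 \<Longrightarrow> summable (\<lambda>l. hyp01_coeff b l * z ^ l)"
  by (rule summable_rabs_cancel) (rule summable_abs_hyp01)

lemma hyp01_at_0: "hyp01 b 0 = 1"
  using powser_zero[of "hyp01_coeff b"] by (simp add: hyp01_def hyp01_coeff_def)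

text \<open>
  The differential equation is the two-term recurrence of the coefficients, summed.
\<close>
lemma hyp01_ode:
  assumes b: "b > 0"
  obtains g' g'' where
    "\<And>z. (hyp01 b has_field_derivative g' z) (at z)"
    "\<And>z. (g' has_field_derivative g'' z) (at z)"
    "\<And>z. z * g'' z + b * g' z + hyp01 b z = 0"
proof -
  define a where "a = hyp01_coeff b"
  define P where "P c z = (\<Sum>l. c l * z ^ l)" for c :: "nat \<Rightarrow> real" and z
  have s0: "summable (\<lambda>l. a l * z ^ l)" for z
    using summable_hyp01[OF b] by (simp add: a_def)
  have s1: "summable (\<lambda>l. diffs a l * z ^ l)" for z
    by (rule termdiff_converges_all) (rule s0)
  have s2: "summable (\<lambda>l. diffs (diffs a) l * z ^ l)" for z
    by (rule termdiff_converges_all) (rule s1)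
  have d1: "(hyp01 b has_field_derivative P (diffs a) z) (at z)" for z
    using termdiffs_strong_converges_everywhere[OF s0]
    unfolding P_def a_def hyp01_def[abs_def] .
  have d2: "(P (diffs a) has_field_derivative P (diffs (diffs a)) z) (at z)" for z
    using termdiffs_strong_converges_everywhere[OF s1] unfolding P_def[abs_def] .
  have ode: "z * P (diffs (diffs a)) z + b * P (diffs a) z + hyp01 b z = 0" for z
  proof -
    have "(\<lambda>l. z * (diffs (diffs a) l * z ^ l)) sums (z * P (diffs (diffs a)) z)"
      unfolding P_def by (intro sums_mult summable_sums s2)
    then have "(\<lambda>l. real (Suc l) * (real (Suc (Suc l)) * a (Suc (Suc l))) * z ^ Suc l)
        sums (z * P (diffs (diffs a)) z)"
      by (simp add: diffs_def mult_ac)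
    then have A: "(\<lambda>l. real l * (real (Suc l) * a (Suc l)) * z ^ l) sums (z * P (diffs (diffs a)) z)"
      by (subst (asm) sums_Suc_iff) simp
    have B: "(\<lambda>l. b * (real (Suc l) * a (Suc l) * z ^ l)) sums (b * P (diffs a) z)"
      using sums_mult[OF summable_sums[OF s1]] by (simp add: diffs_def P_def)
    have C: "(\<lambda>l. a l * z ^ l) sums hyp01 b z"
      using summable_sums[OF s0] by (simp add: a_def hyp01_def)
    have "real l * (real (Suc l) * a (Suc l)) * z ^ l + b * (real (Suc l) * a (Suc l) * z ^ l)
        + a l * z ^ l = 0" for l
    proof -
      have "real l * (real (Suc l) * a (Suc l)) * z ^ l + b * (real (Suc l) * a (Suc l) * z ^ l)
          + a l * z ^ l = (a (Suc l) * ((real l + 1) * (b + real l)) + a l) * z ^ l"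
        by (simp add: algebra_simps)
      then show ?thesis using hyp01_coeff_Suc[OF b, of l] by (simp add: a_def)
    qed
    with sums_add[OF sums_add[OF A B] C]
    have "(\<lambda>l. 0) sums (z * P (diffs (diffs a)) z + b * P (diffs a) z + hyp01 b z)" by simp
    then show ?thesis using sums_unique2[OF sums_zero] by fastforce
  qed
  show thesis by (rule that[OF d1 d2 ode])
qed

text \<open>
  The energy \<open>E = g\<^sup>2 + z g'\<^sup>2\<close> of a solution of \<open>z g'' + b g' + g = 0\<close> satisfies
  \<open>E' = (1 - 2 b) g'\<^sup>2\<close>.  So it does not increase when \<open>b \<ge> 1/2\<close>, and it starts at \<open>g(0)\<^sup>2 = 1\<close>.
  For Bessel functions this is the bound \<open>\<bar>J\<^sub>\<nu>(x)\<bar> \<le> (x/2)\<^sup>\<nu> / \<Gamma>(\<nu> + 1)\<close> for \<open>\<nu> \<ge> -1/2\<close>.  Bounding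
  the series term by term would lose a factor that grows exponentially when \<open>x\<close> is proportional to
  \<open>\<nu>\<close>, which the final estimate cannot absorb.
\<close>
lemma abs_hyp01_le_1:
  assumes b: "b \<ge> 1/2" and z: "z \<ge> 0"
  shows "\<bar>hyp01 b z\<bar> \<le> 1"
proof -
  obtain g' g'' where d1: "\<And>z. (hyp01 b has_field_derivative g' z) (at z)"
    and d2: "\<And>z. (g' has_field_derivative g'' z) (at z)"
    and ode: "\<And>z. z * g'' z + b * g' z + hyp01 b z = 0"
    using hyp01_ode[of b] b by auto
  define E where "E = (\<lambda>z. (hyp01 b z)\<^sup>2 + z * (g' z)\<^sup>2)"
  have dE: "(E has_field_derivative - (2 * b - 1) * (g' t)\<^sup>2) (at t)" for t
  proof -
    have "t * g'' t = - b * g' t - hyp01 b t" using ode[of t] by linarith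
    then have "2 * hyp01 b t * g' t + ((g' t)\<^sup>2 + 2 * g' t * (t * g'' t)) = - (2 * b - 1) * (g' t)\<^sup>2"
      by (simp only:) (simp add: power2_eq_square algebra_simps)
    moreover have "(E has_field_derivative
        2 * hyp01 b t * g' t + ((g' t)\<^sup>2 + 2 * g' t * (t * g'' t))) (at t)"
      unfolding E_def by (rule derivative_eq_intros d1 d2 refl)+ (simp add: algebra_simps)
    ultimately show ?thesis by simp
  qed
  have "E z \<le> E 0"
  proof (rule DERIV_nonpos_imp_nonincreasing[OF z])
    fix t
    have "- (2 * b - 1) * (g' t)\<^sup>2 \<le> 0" using b by (intro mult_nonpos_nonneg) auto
    with dE show "\<exists>y. DERIV E t :> y \<and> y \<le> 0" by blast
  qed
  then have "(hyp01 b z)\<^sup>2 + z * (g' z)\<^sup>2 \<le> 1" by (simp add: E_def hyp01_at_0)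
  moreover have "z * (g' z)\<^sup>2 \<ge> 0" using z by simp
  ultimately have "(hyp01 b z)\<^sup>2 \<le> 1" by linarith
  then show ?thesis by (simp add: abs_square_le_1)
qed

text \<open>
  The kernel is \<open>x\<^sup>N\<close> times an entire function of \<open>x\<^sup>2\<close>, because the half-integer power
  \<open>x powr (p/2)\<close> cancels.  Continuity of that function gives the value of the limit at \<open>0\<close>.
\<close>
lemma H_kernel_eq_hyp01:
  fixes p :: int and N :: nat
  assumes p: "p \<ge> -1" and x: "x \<ge> 0"
  defines "b \<equiv> real N + real_of_int p / 2 + 1"
  shows "H_kernel p N x = rGamma b * (1/2) powr (b - 1) * (x ^ N * hyp01 b (x\<^sup>2 / 4))"
proof -
  define \<nu> where "\<nu> = real N + real_of_int p / 2"
  have b: "b > 0" "b = \<nu> + 1" using p by (auto simp: b_def \<nu>_def)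
  define C where "C = rGamma b * (1/2) powr (b - 1)"
  define F where "F = (\<lambda>x. C * (x ^ N * hyp01 b (x\<^sup>2 / 4)))"
  define K where "K = (\<lambda>y. bessel_J \<nu> y / y powr (real_of_int p / 2))"
  have K: "K y = F y" if y: "y > 0" for y
  proof -
    have coeff: "(-1) ^ m * rGamma (\<nu> + real m + 1) / fact m * (y / 2) powr (2 * real m + \<nu>)
        = C * y powr \<nu> * (hyp01_coeff b m * (y\<^sup>2 / 4) ^ m)" for m
    proof -
      have g: "rGamma (\<nu> + real m + 1) = rGamma b / pochhammer b m"
        using pochhammer_rGamma[of b m] pochhammer_pos[of b m] b by (simp add: add_ac)
      have "(y / 2) powr (2 * real m + \<nu>) = (y / 2) powr \<nu> * (y / 2) powr real (2 * m)"
        by (simp add: powr_add)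
      also have "(y / 2) powr real (2 * m) = (y / 2) ^ (2 * m)"
        using y by (subst powr_realpow) auto
      also have "\<dots> = (y\<^sup>2 / 4) ^ m"
        by (simp add: power_mult power_divide)
      also have "(y / 2) powr \<nu> = (1 / 2) powr (b - 1) * y powr \<nu>"
        using powr_mult[of "1/2" y \<nu>] y b by simp
      finally show ?thesis
        by (simp add: C_def hyp01_coeff_def g mult_ac)
    qed
    have "bessel_J \<nu> y = C * y powr \<nu> * hyp01 b (y\<^sup>2 / 4)"
      unfolding bessel_J_def coeff hyp01_def using b
      by (intro suminf_mult summable_hyp01)
    moreover have "y powr \<nu> = y powr (real_of_int p / 2) * y ^ N"
      using y by (simp add: \<nu>_def powr_add powr_realpow)
    ultimately show ?thesis using y by (simp add: K_def F_def)
  qed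
  have "H_kernel p N x = (if x > 0 then K x else Lim (at_right 0) K)"
    by (simp add: H_kernel_def K_def \<nu>_def)
  moreover have "Lim (at_right 0) K = F 0"
  proof (rule tendsto_Lim)
    have "isCont (hyp01 b) z" for z
      using hyp01_ode[OF b(1)] DERIV_isCont by metis
    then have "isCont F 0"
      unfolding F_def by (intro continuous_intros isCont_o2[where f = "\<lambda>x. x\<^sup>2 / 4" and g = "hyp01 b"]) auto
    then have "(F \<longlongrightarrow> F 0) (at_right 0)"
      by (metis filterlim_at_split isCont_def)
    then show "(K \<longlongrightarrow> F 0) (at_right 0)"
      by (rule Lim_transform_eventually)
        (auto simp: K eventually_at_right_less intro: eventually_mono[OF eventually_at_right_less])
  qed simp
  ultimately show ?thesis using x K[of x] by (cases "x > 0") (auto simp: F_def C_def)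
qed

section \<open>Moments of the radial Zernike polynomials\<close>

lemma space_radial_measure: "space (radial_measure p) = {0..1}"
  by (simp add: radial_measure_def space_restrict_space)

lemma measurable_radial_measure:
  "f \<in> borel_measurable borel \<Longrightarrow> f \<in> borel_measurable (radial_measure p)"
  unfolding radial_measure_def by (simp add: measurable_restrict_space1)

lemma has_bochner_integral_radial_power:
  assumes p: "p \<ge> -1"
  shows "has_bochner_integral (radial_measure p) (\<lambda>r. r ^ q) (1 / (real q + real_of_int p + 2))"
proof -
  have e: "real (nat (p + 1) + q) + 1 = real q + real_of_int p + 2" using p by simp
  have "integrable lborel (\<lambda>r::real. indicator {0..1} r *\<^sub>R r ^ (nat (p + 1) + q))"
    by (rule borel_integrable_compact) (auto intro!: continuous_intros)
  then have "has_bochner_integral lborel (\<lambda>r::real. indicator {0..1} r *\<^sub>R r ^ (nat (p + 1) + q))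
      (1 / (real q + real_of_int p + 2))"
    using integral_power[of 0 1 "nat (p + 1) + q"] e
    by (simp add: has_bochner_integral_iff mult.commute add_ac)
  then have "has_bochner_integral (restrict_space lborel {0..1})
      (\<lambda>r. r ^ nat (p + 1) *\<^sub>R r ^ q) (1 / (real q + real_of_int p + 2))"
    by (simp add: has_bochner_integral_iff integrable_restrict_space integral_restrict_space power_add)
  then show ?thesis
    unfolding radial_measure_def
    by (intro has_bochner_integral_density)
      (auto simp: measurable_restrict_space1 AE_restrict_space_iff)
qed

text \<open>
  The substitution \<open>t = r\<^sup>2\<close> would turn this into a beta integral; induction on \<open>j\<close> with
  \<open>(1 - r\<^sup>2)\<^sup>j\<^sup>+\<^sup>1 = (1 - r\<^sup>2)\<^sup>j - r\<^sup>2 (1 - r\<^sup>2)\<^sup>j\<close> gives the value directly.  The Pochhammer symbol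
  stands for a quotient of values of the gamma function.
\<close>
lemma has_bochner_integral_radial_beta:
  assumes p: "p \<ge> -1"
  shows "has_bochner_integral (radial_measure p) (\<lambda>r. r ^ q * (1 - r\<^sup>2) ^ j)
    (fact j / (2 * pochhammer ((real q + real_of_int p) / 2 + 1) (Suc j)))"
proof (induction j arbitrary: q)
  case 0
  have "1 / (real q + real_of_int p + 2) = fact 0 / (2 * pochhammer ((real q + real_of_int p) / 2 + 1) (Suc 0))"
    unfolding pochhammer_Suc0 by (simp add: distrib_left add_ac)
  then show ?case using has_bochner_integral_radial_power[OF p, of q] by (simp only: power_0 mult_1_right)
next
  case (Suc j)
  define z where "z = (real q + real_of_int p) / 2 + 1"
  define P where "P = pochhammer (z + 1) j"
  have "real q + real_of_int p + 2 > 0" using p by linarith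
  moreover have "z = (real q + real_of_int p + 2) / 2" by (simp add: z_def add_divide_distrib)
  ultimately have "z > 0" by simp
  then have pos: "z > 0" "z + 1 + real j > 0" "P > 0"
    by (auto simp: P_def intro!: pochhammer_pos)
  have "has_bochner_integral (radial_measure p)
      (\<lambda>r. r ^ q * (1 - r\<^sup>2) ^ j - r ^ (q + 2) * (1 - r\<^sup>2) ^ j)
      (fact j / (2 * pochhammer z (Suc j)) - fact j / (2 * pochhammer (z + 1) (Suc j)))"
    using has_bochner_integral_diff[OF Suc.IH[of q] Suc.IH[of "q + 2"]]
    by (simp add: z_def add_divide_distrib add_ac)
  moreover have "r ^ q * (1 - r\<^sup>2) ^ j - r ^ (q + 2) * (1 - r\<^sup>2) ^ j = r ^ q * (1 - r\<^sup>2) ^ Suc j" for r :: real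
    by (simp add: algebra_simps power2_eq_square)
  moreover have "fact j / (2 * pochhammer z (Suc j)) - fact j / (2 * pochhammer (z + 1) (Suc j))
      = fact (Suc j) / (2 * pochhammer z (Suc (Suc j)))"
  proof -
    have a: "pochhammer z (Suc j) = z * P" by (simp add: pochhammer_rec P_def)
    have b: "pochhammer (z + 1) (Suc j) = (z + 1 + real j) * P" by (simp add: pochhammer_rec' P_def)
    have c: "pochhammer z (Suc (Suc j)) = z * ((z + 1 + real j) * P)"
      by (subst pochhammer_rec) (simp add: b)
    define w where "w = z + 1 + real j"
    have w: "w \<noteq> 0" "real j = w - z - 1" "z \<noteq> 0" "P \<noteq> 0" using pos by (auto simp: w_def)
    show ?thesis unfolding a b c fact_Suc w_def[symmetric] of_nat_Suc w(2) using w(1,3,4)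
      by (simp add: divide_simps) (simp add: algebra_simps)
  qed
  ultimately show ?case by (simp add: z_def)
qed

text \<open>
  Each summand of the Zernike polynomial contributes a beta integral, and the sum of these is a
  Chu-Vandermonde convolution.  The numerator \<open>(m - k + 1) (m - k + 2) \<dots> m\<close> vanishes for
  \<open>m < k\<close>: this is the orthogonality of the Zernike polynomial to \<open>r\<^sup>N\<^sup>+\<^sup>2\<^sup>m\<close>.
\<close>
lemma has_bochner_integral_zernike_moment:
  fixes p :: int and N :: nat
  assumes p: "p \<ge> -1"
  defines "b \<equiv> real N + real_of_int p / 2 + 1"
  shows "has_bochner_integral (radial_measure p) (\<lambda>r. zernike_R p N k r * r ^ (N + 2 * m))
    (pochhammer (real m + 1 - real k) k / (2 * pochhammer (b + real m) (Suc k)))"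
proof -
  define a where "a = real k + real N + real_of_int p / 2"
  define s where "s = b + real m"
  have s: "s > 0" using p by (simp add: s_def b_def)
  define D where "D = pochhammer s (Suc k)"
  have D: "D > 0" using s by (simp add: D_def pochhammer_pos)
  define f where "f = (\<lambda>j r. ((-1) ^ j * (a gchoose j) * real (k choose j))
      * (r ^ (2 * N + 2 * m + 2 * (k - j)) * (1 - r\<^sup>2) ^ j))"
  have eq: "zernike_R p N k r * r ^ (N + 2 * m) = (\<Sum>j=0..k. f j r)" for r
  proof -
    have "r ^ (2 * N + 2 * m + 2 * (k - j)) = r ^ N * (r\<^sup>2) ^ (k - j) * r ^ (N + 2 * m)" for j
      by (simp add: power_add mult_2 flip: power_mult)
    then show ?thesis
      unfolding zernike_R_def f_def a_def sum_distrib_left sum_distrib_right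
      by (intro sum.cong refl) (simp only: mult_ac)
  qed
  have I: "has_bochner_integral (radial_measure p) (f j)
      (real (k choose j) * pochhammer (- a) j * pochhammer s (k - j) / (2 * D))" if j: "j \<in> {0..k}" for j
  proof -
    \<comment> \<open>The denominators for different \<open>j\<close> are tails of the common denominator \<open>D\<close>.\<close>
    have e: "(real (2 * N + 2 * m + 2 * (k - j)) + real_of_int p) / 2 + 1 = s + real (k - j)"
      by (simp add: s_def b_def add_divide_distrib)
    define P where "P = pochhammer (s + real (k - j)) (Suc j)"
    define Q where "Q = pochhammer s (k - j)"
    have "has_bochner_integral (radial_measure p) (f j)
      (((-1) ^ j * (a gchoose j) * real (k choose j)) * (fact j / (2 * P)))"
      unfolding f_def P_def using has_bochner_integral_radial_beta[OF p, of "2 * N + 2 * m + 2 * (k - j)" j]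
      unfolding e by (intro has_bochner_integral_mult_right) auto
    moreover have "((-1) ^ j * (a gchoose j) * real (k choose j)) * (fact j / (2 * P))
      = real (k choose j) * pochhammer (- a) j * Q / (2 * D)"
    proof -
      have "(-1) ^ j * (a gchoose j) * fact j = pochhammer (- a) j"
        by (simp add: gbinomial_pochhammer flip: power_mult_distrib)
      then have "((-1) ^ j * (a gchoose j) * real (k choose j)) * (fact j / (2 * P))
          = real (k choose j) * pochhammer (- a) j / (2 * P)"
        by (metis (no_types, opaque_lifting) mult.assoc mult.commute times_divide_eq_right)
      moreover have "D = Q * P"
        using pochhammer_product'[of s "k - j" "Suc j"] j by (simp add: D_def P_def Q_def)
      moreover have "Q > 0" using s by (auto simp: Q_def intro!: pochhammer_pos)
      ultimately show ?thesis by simp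
    qed
    ultimately show ?thesis by (simp add: Q_def)
  qed
  have "has_bochner_integral (radial_measure p) (\<lambda>r. \<Sum>j=0..k. f j r)
     (\<Sum>j=0..k. real (k choose j) * pochhammer (- a) j * pochhammer s (k - j) / (2 * D))"
    by (intro has_bochner_integral_sum I)
  also have "(\<Sum>j=0..k. real (k choose j) * pochhammer (- a) j * pochhammer s (k - j) / (2 * D))
     = pochhammer (- a + s) k / (2 * D)"
    unfolding pochhammer_binomial_sum sum_divide_distrib atMost_atLeast0 ..
  also have "- a + s = real m + 1 - real k" by (simp add: a_def s_def b_def)
  finally show ?thesis by (simp add: eq D_def s_def)
qed

section \<open>Power series kernels and the Hankel transform of Zernike polynomials\<close>

lemma integrable_radial_mult_power:
  assumes f: "integrable (radial_measure p) f"
  shows "integrable (radial_measure p) (\<lambda>r. f r * r ^ q)"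
proof (rule Bochner_Integration.integrable_bound[OF f])
  show "(\<lambda>r. f r * r ^ q) \<in> borel_measurable (radial_measure p)"
    by (intro borel_measurable_times measurable_radial_measure borel_measurable_integrable[OF f]) auto
  show "AE r in radial_measure p. norm (f r * r ^ q) \<le> norm (f r)"
    by (rule AE_I2) (auto simp: space_radial_measure abs_mult mult_left_le power_le_one)
qed

lemma radial_integral_powser:
  fixes a :: "nat \<Rightarrow> real"
  assumes f: "integrable (radial_measure p) f" and a: "summable (\<lambda>m. \<bar>a m\<bar>)"
  shows "(\<lambda>m. a m * (LINT r|radial_measure p. f r * r ^ (N + 2 * m)))
    sums (LINT r|radial_measure p. f r * (\<Sum>m. a m * r ^ (N + 2 * m)))"
proof -
  have le1: "\<bar>f r * (a m * r ^ (N + 2 * m))\<bar> \<le> \<bar>f r\<bar> * \<bar>a m\<bar>" if "r \<in> {0..1}" for r m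
  proof -
    have "\<bar>r ^ (N + 2 * m)\<bar> \<le> 1" using that by (simp add: power_le_one)
    then show ?thesis by (simp add: abs_mult mult_left_le mult_left_mono)
  qed
  have int: "integrable (radial_measure p) (\<lambda>r. f r * (a m * r ^ (N + 2 * m)))" for m
    using integrable_mult_right[OF integrable_radial_mult_power[OF f], of "a m"]
    by (simp add: mult_ac)
  have "(\<lambda>m. LINT r|radial_measure p. f r * (a m * r ^ (N + 2 * m)))
    sums (LINT r|radial_measure p. (\<Sum>m. f r * (a m * r ^ (N + 2 * m))))"
  proof (rule sums_integral[OF int])
    show "AE r in radial_measure p. summable (\<lambda>m. norm (f r * (a m * r ^ (N + 2 * m))))"
    proof (rule AE_I2)
      fix r assume "r \<in> space (radial_measure p)"
      then have r: "r \<in> {0..1}" by (simp add: space_radial_measure)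
      show "summable (\<lambda>m. norm (f r * (a m * r ^ (N + 2 * m))))"
        by (rule summable_comparison_test[OF _ summable_mult[OF a, of "\<bar>f r\<bar>"]])
          (use le1[OF r] in auto)
    qed
    show "summable (\<lambda>m. LINT r|radial_measure p. norm (f r * (a m * r ^ (N + 2 * m))))"
    proof (rule summable_comparison_test)
      show "\<exists>n0. \<forall>m\<ge>n0. norm (LINT r|radial_measure p. norm (f r * (a m * r ^ (N + 2 * m))))
          \<le> (LINT r|radial_measure p. \<bar>f r\<bar>) * \<bar>a m\<bar>"
      proof (intro exI allI impI)
        fix m
        have "(LINT r|radial_measure p. norm (f r * (a m * r ^ (N + 2 * m))))
            \<le> (LINT r|radial_measure p. \<bar>f r\<bar> * \<bar>a m\<bar>)"
          by (intro integral_mono integrable_norm int integrable_mult_left integrable_abs f)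
            (use le1 in \<open>simp add: space_radial_measure\<close>)
        then show "norm (LINT r|radial_measure p. norm (f r * (a m * r ^ (N + 2 * m))))
          \<le> (LINT r|radial_measure p. \<bar>f r\<bar>) * \<bar>a m\<bar>" by simp
      qed
    qed (intro summable_mult a)
  qed
  moreover have "(\<Sum>m. f r * (a m * r ^ (N + 2 * m))) = f r * (\<Sum>m. a m * r ^ (N + 2 * m))"
    if "r \<in> space (radial_measure p)" for r
  proof (rule suminf_mult)
    have r: "r \<in> {0..1}" using that by (simp add: space_radial_measure)
    have "norm (a m * r ^ (N + 2 * m)) \<le> \<bar>a m\<bar>" for m
      using r by (simp add: abs_mult mult_left_le power_le_one)
    then show "summable (\<lambda>m. a m * r ^ (N + 2 * m))"
      by (intro summable_comparison_test[OF _ a]) auto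
  qed
  ultimately show ?thesis
    by (simp add: mult.left_commute cong: Bochner_Integration.integral_cong)
qed

text \<open>
  An integral operator whose kernel is a function of the product \<open>r * \<rho>\<close> is symmetric.  For a power
  series, both sides equal \<open>\<Sum>m. a\<^sub>m f\<^sub>m g\<^sub>m\<close>, where \<open>f\<^sub>m\<close> and \<open>g\<^sub>m\<close> are the moments of the two
  functions, so interchanging sums with single integrals is enough.
\<close>
lemma powser_kernel_symmetric:
  fixes a :: "nat \<Rightarrow> real" and N :: nat
  assumes f: "integrable (radial_measure p) f" and g: "integrable (radial_measure p) g"
    and a: "summable (\<lambda>m. \<bar>a m\<bar>)"
  defines "K \<equiv> \<lambda>t. \<Sum>m. a m * t ^ (N + 2 * m)"
  shows "(LINT r|radial_measure p. (LINT \<rho>|radial_measure p. K (r * \<rho>) * f \<rho>) * g r)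
    = (LINT \<rho>|radial_measure p. f \<rho> * (LINT r|radial_measure p. g r * K (\<rho> * r)))"
proof -
  define F where "F = (\<lambda>f m. LINT r|radial_measure p. f r * r ^ (N + 2 * m))"
  have inner: "(LINT \<rho>|radial_measure p. h \<rho> * K (r * \<rho>)) = (\<Sum>m. (a m * F h m) * r ^ (N + 2 * m))"
    and abs: "summable (\<lambda>m. \<bar>a m * F h m\<bar>)"
    if h: "integrable (radial_measure p) h" and r: "r \<in> {0..1}" for h r
  proof -
    have "summable (\<lambda>m. \<bar>a m * r ^ (N + 2 * m)\<bar>)" if "r \<in> {0..1}" for r
    proof (rule summable_comparison_test[OF _ a], intro exI allI impI)
      show "norm \<bar>a m * r ^ (N + 2 * m)\<bar> \<le> \<bar>a m\<bar>" for m
        using that by (simp add: abs_mult mult_left_le power_le_one)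
    qed
    from radial_integral_powser[OF h this[OF r], of N]
    show "(LINT \<rho>|radial_measure p. h \<rho> * K (r * \<rho>)) = (\<Sum>m. (a m * F h m) * r ^ (N + 2 * m))"
      by (simp add: sums_iff K_def F_def power_mult_distrib mult_ac)
    have "\<bar>F h m\<bar> \<le> (LINT r|radial_measure p. \<bar>h r\<bar>)" for m
      unfolding F_def
    proof (rule integral_abs_bound_integral)
      show "integrable (radial_measure p) (\<lambda>r. h r * r ^ (N + 2 * m))"
        by (rule integrable_radial_mult_power[OF h])
    qed (use h in \<open>auto simp: space_radial_measure abs_mult mult_left_le power_le_one\<close>)
    then show "summable (\<lambda>m. \<bar>a m * F h m\<bar>)"
      by (intro summable_comparison_test[OF _ summable_mult2[OF a, of "LINT r|radial_measure p. \<bar>h r\<bar>"]])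
        (auto simp: abs_mult intro!: mult_left_mono)
  qed
  have "(LINT r|radial_measure p. g r * (\<Sum>m. (a m * F f m) * r ^ (N + 2 * m))) = (\<Sum>m. a m * F f m * F g m)"
    using radial_integral_powser[OF g abs[OF f, of 0], of N] by (simp add: sums_iff F_def)
  moreover have "(LINT r|radial_measure p. f r * (\<Sum>m. (a m * F g m) * r ^ (N + 2 * m))) = (\<Sum>m. a m * F g m * F f m)"
    using radial_integral_powser[OF f abs[OF g, of 0], of N] by (simp add: sums_iff F_def)
  moreover have "(LINT r|radial_measure p. (LINT \<rho>|radial_measure p. K (r * \<rho>) * f \<rho>) * g r)
      = (LINT r|radial_measure p. g r * (\<Sum>m. (a m * F f m) * r ^ (N + 2 * m)))"
    by (rule Bochner_Integration.integral_cong[OF refl])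
      (simp add: space_radial_measure inner[OF f, symmetric] mult.commute[of _ "g _"] mult.commute[of _ "f _"])
  moreover have "(LINT \<rho>|radial_measure p. f \<rho> * (LINT r|radial_measure p. g r * K (\<rho> * r)))
      = (LINT r|radial_measure p. f r * (\<Sum>m. (a m * F g m) * r ^ (N + 2 * m)))"
    by (rule Bochner_Integration.integral_cong[OF refl])
      (simp add: space_radial_measure inner[OF g, symmetric])
  ultimately show ?thesis by (simp add: mult_ac)
qed

lemma integrable_zernike_R:
  assumes p: "p \<ge> -1"
  shows "integrable (radial_measure p) (zernike_R p N k)"
proof -
  have "integrable (radial_measure p) (\<lambda>r. ((-1) ^ m * ((real k + real N + real_of_int p / 2) gchoose m)
      * real (k choose m)) * (r ^ N * (r\<^sup>2) ^ (k - m) * (1 - r\<^sup>2) ^ m))" for m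
    using has_bochner_integral_radial_beta[OF p, of "N + 2 * (k - m)" m]
    by (intro integrable_mult_right)
      (auto simp: has_bochner_integral_iff power_add simp flip: power_mult)
  then have "integrable (radial_measure p) (\<lambda>r. \<Sum>m=0..k. ((-1) ^ m * ((real k + real N + real_of_int p / 2) gchoose m)
      * real (k choose m)) * (r ^ N * (r\<^sup>2) ^ (k - m) * (1 - r\<^sup>2) ^ m))"
    by (rule Bochner_Integration.integrable_sum)
  then show ?thesis
    by (simp add: zernike_R_def[abs_def] sum_distrib_left mult_ac)
qed

text \<open>
  With \<open>z = x\<^sup>2/4\<close> and the constants of the Bessel kernel restored, the transform of \<open>R\<^sub>N\<^sub>,\<^sub>k\<close> is
  \<open>(-1)\<^sup>k J\<^sub>\<nu>(x) / x powr (p/2 + 1)\<close> with \<open>\<nu> = N + p/2 + 2k + 1\<close>.  By the moment formula the first \<open>k\<close>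
  terms of the integrated series vanish, and what remains is a multiple of the series with shifted
  parameter.
\<close>
lemma zernike_hankel_transform:
  fixes p :: int and N :: nat
  assumes p: "p \<ge> -1"
  defines "b \<equiv> real N + real_of_int p / 2 + 1"
  shows "(LINT r|radial_measure p. zernike_R p N k r * (r ^ N * hyp01 b (z * r\<^sup>2)))
    = (-1) ^ k * z ^ k / (2 * pochhammer b (2 * k + 1)) * hyp01 (b + real (2 * k + 1)) z"
proof -
  have b: "b > 0" using p by (simp add: b_def)
  define c where "c = (\<lambda>m. hyp01_coeff b m * z ^ m)"
  define M where "M = (\<lambda>m. pochhammer (real m + 1 - real k) k / (2 * pochhammer (b + real m) (Suc k)))"
  have M: "(LINT r|radial_measure p. zernike_R p N k r * r ^ (N + 2 * m)) = M m" for m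
    using has_bochner_integral_zernike_moment[OF p] by (simp add: has_bochner_integral_iff b_def M_def)
  have int: "integrable (radial_measure p) (zernike_R p N k)"
    by (rule integrable_zernike_R[OF p])
  have "(\<lambda>m. c m * M m) sums (LINT r|radial_measure p. zernike_R p N k r * (\<Sum>m. c m * r ^ (N + 2 * m)))"
    using radial_integral_powser[OF int summable_abs_hyp01[OF b, of z], of N] unfolding M c_def .
  moreover have "(\<Sum>m. c m * r ^ (N + 2 * m)) = r ^ N * hyp01 b (z * r\<^sup>2)" for r
  proof -
    have "c m * r ^ (N + 2 * m) = r ^ N * (hyp01_coeff b m * (z * r\<^sup>2) ^ m)" for m
      by (simp add: c_def power_add power_mult_distrib flip: power_mult)
    then show ?thesis
      unfolding hyp01_def by (simp only: suminf_mult[OF summable_hyp01[OF b]])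
  qed
  ultimately have L: "(\<lambda>m. c m * M m) sums
      (LINT r|radial_measure p. zernike_R p N k r * (r ^ N * hyp01 b (z * r\<^sup>2)))" by simp
  have z0: "c m * M m = 0" if "m < k" for m
  proof -
    have "real m + 1 - real k = - real (k - 1 - m)" using that by (simp add: of_nat_diff)
    then have "pochhammer (real m + 1 - real k) k = 0"
      using that by (simp only: pochhammer_of_nat_eq_0_iff)
    then show ?thesis by (simp add: M_def)
  qed
  have shift: "c (l + k) * M (l + k) = (-1) ^ k * z ^ k / (2 * pochhammer b (2 * k + 1))
      * (hyp01_coeff (b + real (2 * k + 1)) l * z ^ l)" for l
  proof -
    \<comment> \<open>Both \<open>S * U\<close> and \<open>Q * R\<close> are \<open>pochhammer b (2 * k + 1 + l)\<close>, split at different places.\<close>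
    define F Q R S U where "F = pochhammer (real l + 1) k" and "Q = pochhammer b (l + k)"
      and "R = pochhammer (b + real (l + k)) (Suc k)" and "S = pochhammer b (2 * k + 1)"
      and "U = pochhammer (b + real (2 * k + 1)) l"
    have pos: "F > 0" "Q > 0" "R > 0" "S > 0" "U > 0"
      using b unfolding F_def Q_def R_def S_def U_def by (auto intro!: pochhammer_pos simp del: pochhammer_Suc)
    have fact: "fact (l + k) = (fact l * F :: real)"
      using pochhammer_product'[of "1::real" l k] by (simp add: pochhammer_fact add_ac F_def)
    have "2 * k + 1 + l = l + k + Suc k" by simp
    then have SU: "S * U = Q * R"
      unfolding S_def U_def Q_def R_def pochhammer_product'[symmetric] by (simp only:)
    have M': "M (l + k) = F / (2 * R)" by (simp add: M_def F_def R_def del: pochhammer_Suc)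
    have "c (l + k) * M (l + k) = (-1) ^ k * z ^ k * ((-1) ^ l * z ^ l) / (fact l * (2 * (Q * R)))"
      unfolding M' c_def hyp01_coeff_def Q_def[symmetric] fact using pos
      by (simp add: power_add mult_ac)
    also have "\<dots> = (-1) ^ k * z ^ k / (2 * S) * (hyp01_coeff (b + real (2 * k + 1)) l * z ^ l)"
      unfolding hyp01_coeff_def U_def[symmetric] SU[symmetric] by (simp add: mult_ac)
    finally show ?thesis by (simp only: S_def)
  qed
  have "(\<lambda>l. c (l + k) * M (l + k)) sums ((-1) ^ k * z ^ k / (2 * pochhammer b (2 * k + 1))
      * hyp01 (b + real (2 * k + 1)) z)"
    unfolding shift hyp01_def using b by (intro sums_mult summable_sums summable_hyp01) auto
  then have "(\<lambda>m. c m * M m) sums ((-1) ^ k * z ^ k / (2 * pochhammer b (2 * k + 1))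
      * hyp01 (b + real (2 * k + 1)) z)"
    using sums_zero_iff_shift[of k "\<lambda>m. c m * M m"] z0 by blast
  with L show ?thesis by (rule sums_unique2)
qed

section \<open>The estimate\<close>

text \<open>
  A weak form of Stirling's bound: \<open>e\<^sup>n \<ge> n\<^sup>n / n!\<close> because the right-hand side is one term of the
  exponential series.  For \<open>p \<ge> 0\<close> the functional equation of \<open>Gamma\<close> yields the additional factor
  \<open>n + p/2 + 1 > sqrt (p + 2)\<close>; for \<open>p = -1\<close> strict monotonicity of \<open>Gamma\<close> suffices.
\<close>
lemma power_div_exp_less_Gamma:
  assumes n: "n \<ge> 1" and p: "p \<ge> -1"
  shows "(real n / exp 1) ^ n * sqrt (real_of_int p + 2) < Gamma (real n + real_of_int p / 2 + 2)"
proof -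
  have sm: "summable (\<lambda>m. real n ^ m /\<^sub>R fact m)" by (rule summable_exp_generic)
  have "(\<Sum>m\<in>{n}. real n ^ m /\<^sub>R fact m) \<le> (\<Sum>m. real n ^ m /\<^sub>R fact m)"
    by (intro sum_le_suminf sm) auto
  then have "real n ^ n / fact n \<le> exp (real n)" by (simp add: exp_def divide_inverse mult.commute)
  moreover have "exp (real n) = exp (1::real) ^ n" by (simp add: exp_of_nat_mult[symmetric])
  ultimately have fact: "(real n / exp 1) ^ n \<le> fact n"
    by (simp add: power_divide field_simps)
  have G: "Gamma (real n + 1) = fact n" by (simp add: Gamma_fact add.commute)
  show ?thesis
  proof (cases "p = -1")
    case True
    have "Gamma (real n + 1) < Gamma (real n + 3 / 2)"
      using n by (intro Gamma_real_strict_mono) auto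
    with True fact G show ?thesis by (simp add: add.commute)
  next
    case False
    with p have p0: "p \<ge> 0" by simp
    define x where "x = real n + real_of_int p / 2 + 1"
    have "sqrt (real_of_int p + 2) < real_of_int p / 2 + 2"
      using p0 by (intro real_less_lsqrt) (auto simp: power2_eq_square field_simps intro: add_nonneg_pos)
    also have "\<dots> \<le> x" using n by (simp add: x_def)
    finally have A: "sqrt (real_of_int p + 2) < x" .
    have B: "fact n \<le> Gamma x"
    proof (cases "p = 0")
      case False
      then have "Gamma (real n + 1) < Gamma x"
        using p0 n by (intro Gamma_real_strict_mono) (auto simp: x_def)
      then show ?thesis using G by simp
    qed (use G in \<open>simp add: x_def\<close>)
    have "(real n / exp 1) ^ n * sqrt (real_of_int p + 2) \<le> fact n * sqrt (real_of_int p + 2)"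
      using fact p0 by (intro mult_right_mono) auto
    also have "\<dots> < fact n * x" using A by simp
    also have "\<dots> \<le> Gamma x * x" using B p0 by (intro mult_right_mono) (auto simp: x_def)
    also have "\<dots> = Gamma (x + 1)"
      using p0 by (subst Gamma_plus1) (auto simp: x_def elim!: nonpos_Ints_cases)
    finally show ?thesis by (simp add: x_def add_ac)
  qed
qed

text \<open>
  The measure is finite, so \<open>\<bar>f\<bar> \<le> 1 + f\<^sup>2\<close> is an integrable bound.
\<close>
lemma integrable_of_radial_L2:
  assumes p: "p \<ge> -1" and f: "radial_L2 p f"
  shows "integrable (radial_measure p) f"
proof (rule Bochner_Integration.integrable_bound)
  have "integrable (radial_measure p) (\<lambda>r. r ^ 0)"
    using has_bochner_integral_radial_power[OF p, of 0] by (simp only: has_bochner_integral_iff)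
  then show "integrable (radial_measure p) (\<lambda>r. r ^ 0 + (f r)\<^sup>2)"
    using f unfolding radial_L2_def by (intro Bochner_Integration.integrable_add) auto
  show "AE r in radial_measure p. norm (f r) \<le> norm (r ^ 0 + (f r)\<^sup>2)"
  proof (rule AE_I2)
    fix r
    have "0 \<le> (1 - \<bar>f r\<bar>)\<^sup>2" "0 \<le> (f r)\<^sup>2" by simp_all
    then show "norm (f r) \<le> norm (r ^ 0 + (f r)\<^sup>2)" by (simp add: power2_eq_square algebra_simps)
  qed
qed (use f in \<open>simp add: radial_L2_def\<close>)

text \<open>
  The Cauchy-Schwarz inequality against \<open>r\<^sup>q\<close>, whose squared norm is \<open>1 / (2 q + p + 2) = 1 / A\<^sup>2\<close>.
  With \<open>f\<close> of norm 1 it follows by integrating \<open>2 A \<bar>f\<bar> r\<^sup>q \<le> f\<^sup>2 + A\<^sup>2 r\<^sup>2\<^sup>q\<close>.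
\<close>
lemma radial_integral_power_bound:
  assumes p: "p \<ge> -1" and f: "radial_L2 p f" and norm: "(LINT r|radial_measure p. (f r)\<^sup>2) = 1"
    and h: "\<And>r. r \<in> {0..1} \<Longrightarrow> \<bar>h r\<bar> \<le> r ^ q"
  shows "\<bar>LINT r|radial_measure p. f r * h r\<bar> \<le> 1 / sqrt (2 * real q + real_of_int p + 2)"
proof (cases "integrable (radial_measure p) (\<lambda>r. f r * h r)")
  case True
  define A where "A = sqrt (2 * real q + real_of_int p + 2)"
  have A: "A > 0" "A * A = 2 * real q + real_of_int p + 2" using p by (auto simp: A_def)
  have power: "has_bochner_integral (radial_measure p) (\<lambda>r. r ^ (2 * q)) (1 / (A * A))"
    using has_bochner_integral_radial_power[OF p, of "2 * q"] by (simp add: A(2))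
  have bound: "has_bochner_integral (radial_measure p)
      (\<lambda>r. (f r)\<^sup>2 * (1 / (2 * A)) + r ^ (2 * q) * (A / 2)) (1 * (1 / (2 * A)) + 1 / (A * A) * (A / 2))"
    using f norm
    by (intro has_bochner_integral_add has_bochner_integral_mult_left power)
      (auto simp: radial_L2_def has_bochner_integral_iff)
  have "\<bar>LINT r|radial_measure p. f r * h r\<bar>
      \<le> (LINT r|radial_measure p. (f r)\<^sup>2 * (1 / (2 * A)) + r ^ (2 * q) * (A / 2))"
  proof (rule integral_abs_bound_integral[OF True])
    fix r assume "r \<in> space (radial_measure p)"
    then have r: "r \<in> {0..1}" by (simp add: space_radial_measure)
    have "\<bar>f r * h r\<bar> \<le> \<bar>f r\<bar> * r ^ q"
      using h[OF r] by (simp add: abs_mult mult_left_mono)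
    also have "\<dots> \<le> (f r)\<^sup>2 * (1 / (2 * A)) + r ^ (2 * q) * (A / 2)"
    proof -
      have "0 \<le> (\<bar>f r\<bar> - A * r ^ q)\<^sup>2" by simp
      also have "(\<bar>f r\<bar> - A * r ^ q)\<^sup>2 = (f r)\<^sup>2 + A * A * r ^ (2 * q) - 2 * A * (\<bar>f r\<bar> * r ^ q)"
        unfolding power2_diff power_mult_distrib power2_abs power_even_eq power2_eq_square[of A] by simp
      finally show ?thesis using A(1) by (simp add: field_simps)
    qed
    finally show "\<bar>f r * h r\<bar> \<le> (f r)\<^sup>2 * (1 / (2 * A)) + r ^ (2 * q) * (A / 2)" .
  qed (use bound in \<open>simp add: has_bochner_integral_iff\<close>)
  also have "\<dots> = 1 / A"
    using bound A(1) by (simp add: has_bochner_integral_iff)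
  finally show ?thesis by (simp add: A_def)
  \<comment> \<open>If the product is not integrable, its integral is \<open>0\<close> by convention.\<close>
qed (use p in \<open>simp add: not_integrable_integral_eq\<close>)

text \<open>
  The operator moves from the eigenfunction to the Zernike polynomial, whose transform is
  \<open>T \<rho>\<^sup>M\<close> times a function bounded by 1.  The norm of \<open>\<rho>\<^sup>M\<close> is exactly the reciprocal of the
  normalizing factor \<open>A\<close> of the normalized Zernike polynomial, so only \<open>\<bar>T\<bar>\<close> is left.
\<close>
lemma eigenfunction_zernike_bound:
  fixes p :: int and N k :: nat
  assumes p: "p \<ge> -1" and c: "c \<ge> 0"
    and f: "radial_L2 p f" and norm: "(LINT r|radial_measure p. (f r)\<^sup>2) = 1"
    and eig: "\<And>r. r \<in> {0..1} \<Longrightarrow> H_op p c N f r = \<mu> * f r"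
  defines "M \<equiv> N + 2 * k"
  shows "\<bar>\<mu>\<bar> * \<bar>LINT r|radial_measure p. f r * zernike_Rbar p N k r\<bar>
    \<le> (1/2) powr (real M + real_of_int p / 2 + 1) * c ^ M / Gamma (real M + real_of_int p / 2 + 2)"
proof -
  define b where "b = real N + real_of_int p / 2 + 1"
  have b: "b > 0" "b \<ge> 1/2" using p by (auto simp: b_def)
  define g where "g = zernike_R p N k"
  define \<kappa> where "\<kappa> = rGamma b * (1/2) powr (b - 1)"
  define a where "a = (\<lambda>m. \<kappa> * c ^ N * (hyp01_coeff b m * (c\<^sup>2 / 4) ^ m))"
  define K where "K = (\<lambda>t. \<Sum>m. a m * t ^ (N + 2 * m))"
  define A where "A = sqrt (2 * real M + real_of_int p + 2)"
  have A: "A > 0" using p by (simp add: A_def)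
  have f_int: "integrable (radial_measure p) f" by (rule integrable_of_radial_L2[OF p f])
  have g_int: "integrable (radial_measure p) g" unfolding g_def by (rule integrable_zernike_R[OF p])
  have K_eq: "K t = \<kappa> * ((c * t) ^ N * hyp01 b ((c * t)\<^sup>2 / 4))" for t
  proof -
    have "a m * t ^ (N + 2 * m) = (\<kappa> * (c * t) ^ N) * (hyp01_coeff b m * ((c * t)\<^sup>2 / 4) ^ m)" for m
      by (simp add: a_def power_add power_mult_distrib power_divide mult_ac flip: power_mult)
    then show ?thesis
      unfolding K_def hyp01_def by (simp add: suminf_mult[OF summable_hyp01[OF b(1)]])
  qed
  have a_sum: "summable (\<lambda>m. \<bar>a m\<bar>)"
    unfolding a_def abs_mult[of "\<kappa> * c ^ N"] by (intro summable_mult summable_abs_hyp01 b)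
  have "\<mu> * (LINT r|radial_measure p. f r * g r)
      = (LINT r|radial_measure p. (LINT \<rho>|radial_measure p. K (r * \<rho>) * f \<rho>) * g r)"
  proof -
    have "\<mu> * (f r * g r) = (LINT \<rho>|radial_measure p. K (r * \<rho>) * f \<rho>) * g r" if r: "r \<in> {0..1}" for r
    proof -
      have "H_op p c N f r = (LINT \<rho>|radial_measure p. K (r * \<rho>) * f \<rho>)"
        unfolding H_op_def
      proof (rule Bochner_Integration.integral_cong[OF refl])
        fix \<rho> assume "\<rho> \<in> space (radial_measure p)"
        then have "H_kernel p N (c * r * \<rho>) = K (r * \<rho>)"
          using H_kernel_eq_hyp01[OF p, of "c * r * \<rho>" N] c r
          by (simp add: K_eq \<kappa>_def b_def space_radial_measure mult.assoc)
        then show "H_kernel p N (c * r * \<rho>) * f \<rho> = K (r * \<rho>) * f \<rho>" by simp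
      qed
      then show ?thesis using eig[OF r] by simp
    qed
    then have "(LINT r|radial_measure p. \<mu> * (f r * g r))
      = (LINT r|radial_measure p. (LINT \<rho>|radial_measure p. K (r * \<rho>) * f \<rho>) * g r)"
      by (intro Bochner_Integration.integral_cong) (auto simp: space_radial_measure)
    then show ?thesis by simp
  qed
  also have "\<dots> = (LINT \<rho>|radial_measure p. f \<rho> * (LINT r|radial_measure p. g r * K (\<rho> * r)))"
    unfolding K_def by (rule powser_kernel_symmetric[OF f_int g_int a_sum])
  finally have adj: "\<mu> * (LINT r|radial_measure p. f r * g r)
      = (LINT \<rho>|radial_measure p. f \<rho> * (LINT r|radial_measure p. g r * K (\<rho> * r)))" .
  define P where "P = pochhammer b (2 * k + 1)"
  have P: "P > 0" unfolding P_def by (rule pochhammer_pos[OF b(1)])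
  define T where "T = \<kappa> * c ^ M * (-1) ^ k / (2 ^ (2 * k + 1) * P)"
  have inner: "(LINT r|radial_measure p. g r * K (\<rho> * r))
      = T * (\<rho> ^ M * hyp01 (b + real (2 * k + 1)) ((c * \<rho>)\<^sup>2 / 4))" for \<rho>
  proof -
    define z where "z = (c * \<rho>)\<^sup>2 / 4"
    have "g r * K (\<rho> * r) = \<kappa> * (c * \<rho>) ^ N * (g r * (r ^ N * hyp01 b (z * r\<^sup>2)))" for r
      by (simp add: K_eq z_def power_mult_distrib mult_ac)
    then have "(LINT r|radial_measure p. g r * K (\<rho> * r))
        = \<kappa> * (c * \<rho>) ^ N * (LINT r|radial_measure p. g r * (r ^ N * hyp01 b (z * r\<^sup>2)))"
      by (simp only: integral_mult_right_zero)
    also have "\<dots> = \<kappa> * (c * \<rho>) ^ N * ((-1) ^ k * z ^ k / (2 * P)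
        * hyp01 (b + real (2 * k + 1)) z)"
      by (simp only: g_def P_def b_def zernike_hankel_transform[OF p])
    also have "z ^ k = (c * \<rho>) ^ (2 * k) / 2 ^ (2 * k)"
      by (simp add: z_def power_divide power_mult)
    also have "\<kappa> * (c * \<rho>) ^ N * ((-1) ^ k * ((c * \<rho>) ^ (2 * k) / 2 ^ (2 * k)) / (2 * P)
        * hyp01 (b + real (2 * k + 1)) z) = T * (\<rho> ^ M * hyp01 (b + real (2 * k + 1)) z)"
    proof -
      have split: "x ^ M = x ^ N * x ^ (2 * k)" for x :: real by (simp only: M_def power_add)
      have two: "2 ^ (2 * k + 1) = 2 ^ (2 * k) * (2 :: real)" by simp
      have alg: "\<kappa> * (u * v) * (e * (u' * v' / w) / (2 * P) * h)
          = \<kappa> * (u * u') * e / (w * 2 * P) * (v * v' * h)" for u v u' v' e w h :: real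
        by (simp add: mult_ac)
      show ?thesis unfolding T_def split two power_mult_distrib by (rule alg)
    qed
    finally show ?thesis by (simp add: z_def)
  qed
  have "\<bar>\<mu> * (LINT r|radial_measure p. f r * g r)\<bar>
      = \<bar>T\<bar> * \<bar>LINT \<rho>|radial_measure p. f \<rho> * (\<rho> ^ M * hyp01 (b + real (2 * k + 1)) ((c * \<rho>)\<^sup>2 / 4))\<bar>"
    unfolding adj inner by (simp add: mult.left_commute[of _ T] abs_mult)
  also have "\<dots> \<le> \<bar>T\<bar> * (1 / A)"
    unfolding A_def
  proof (intro mult_left_mono radial_integral_power_bound[OF p f norm] abs_ge_zero)
    fix r :: real assume r: "r \<in> {0..1}"
    have "\<bar>hyp01 (b + real (2 * k + 1)) ((c * r)\<^sup>2 / 4)\<bar> \<le> 1"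
      using b by (intro abs_hyp01_le_1) auto
    then show "\<bar>r ^ M * hyp01 (b + real (2 * k + 1)) ((c * r)\<^sup>2 / 4)\<bar> \<le> r ^ M"
      using r by (simp add: abs_mult mult_left_le)
  qed
  finally have bound: "\<bar>\<mu>\<bar> * \<bar>LINT r|radial_measure p. f r * g r\<bar> \<le> \<bar>T\<bar> / A"
    by (simp add: abs_mult)
  have T: "\<bar>T\<bar> = (1/2) powr (real M + real_of_int p / 2 + 1) * c ^ M / Gamma (real M + real_of_int p / 2 + 2)"
  proof -
    have e: "b + real (2 * k + 1) = real M + real_of_int p / 2 + 2"
      "real M + real_of_int p / 2 + 1 = (b - 1) + real (2 * k + 1)"
      by (simp_all add: b_def M_def)
    have "(1/2) powr (real M + real_of_int p / 2 + 1) = (1/2) powr (b - 1) * (1/2) powr real (2 * k + 1)"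
      unfolding e(2) powr_add ..
    also have "(1/2) powr real (2 * k + 1) = (1/2 :: real) ^ (2 * k + 1)"
      by (rule powr_realpow) simp
    finally have pw: "(1/2) powr (real M + real_of_int p / 2 + 1) = (1/2) powr (b - 1) / 2 ^ (2 * k + 1)"
      by (simp add: power_divide)
    define G where "G = Gamma (real M + real_of_int p / 2 + 2)"
    have G: "G > 0" using p unfolding G_def by (intro Gamma_real_pos) linarith
    have "rGamma b = P * inverse G"
      unfolding P_def G_def using pochhammer_rGamma[of b "2 * k + 1"]
      unfolding e(1) rGamma_inverse_Gamma .
    then have \<kappa>: "\<kappa> = P * inverse G * (1/2) powr (b - 1)" by (simp only: \<kappa>_def)
    have "\<kappa> \<ge> 0" unfolding \<kappa> using P G by simp
    moreover have "\<bar>(-1) ^ k\<bar> = (1 :: real)" by (simp add: power_abs)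
    ultimately have "\<bar>T\<bar> = \<kappa> * c ^ M / (2 ^ (2 * k + 1) * P)"
      unfolding T_def abs_mult abs_divide using P c by simp
    moreover have "P * inverse G * x * y / (w * P) = x / w * y / G" for x y w
      using P G by (cases "w = 0") (simp_all add: field_simps)
    ultimately show ?thesis unfolding pw G_def[symmetric] \<kappa> by (simp only:)
  qed
  have Rbar: "zernike_Rbar p N k r = A * g r" for r
    by (simp add: zernike_Rbar_def A_def g_def M_def algebra_simps)
  have "\<bar>\<mu>\<bar> * \<bar>LINT r|radial_measure p. f r * zernike_Rbar p N k r\<bar>
      = A * (\<bar>\<mu>\<bar> * \<bar>LINT r|radial_measure p. f r * g r\<bar>)"
    using A by (simp add: Rbar mult.left_commute[of _ A] abs_mult)
  also have "\<dots> \<le> A * (\<bar>T\<bar> / A)" using bound A by (intro mult_left_mono) auto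
  also have "\<dots> = \<bar>T\<bar>" using A by simp
  finally show ?thesis unfolding T .
qed

theorem theorem3p3:
  fixes p :: int and c :: real
    and \<beta> :: "nat \<Rightarrow> nat \<Rightarrow> real" and \<Phi> :: "nat \<Rightarrow> nat \<Rightarrow> real \<Rightarrow> real"
    and N n k :: nat
  assumes "p \<ge> -1"
    and "c > 0"
    and "\<And>N. H_eigensystem p c N (\<beta> N) (\<Phi> N)"
    and "real (N + 2 * k) \<ge> exp 1 * c"
  shows "\<bar>LINT r|radial_measure p. \<Phi> N n r * zernike_Rbar p N k r\<bar>
    < (real_of_int p + 2) powr (-1/2) * inverse \<bar>\<beta> N n\<bar>
      * (1/2) powr (real N + real_of_int p / 2 + 2 * real k + 1)"
proof -
  note p = assms(1)
  define M where "M = N + 2 * k"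
  define G where "G = Gamma (real M + real_of_int p / 2 + 2)"
  define s where "s = sqrt (real_of_int p + 2)"
  define W where "W = (1/2 :: real) powr (real M + real_of_int p / 2 + 1)"
  have "H_eigensystem p c N (\<beta> N) (\<Phi> N)" by (rule assms(3))
  then have eig: "radial_L2 p (\<Phi> N n)" "(LINT r|radial_measure p. (\<Phi> N n r)\<^sup>2) = 1"
    "\<And>r. r \<in> {0..1} \<Longrightarrow> H_op p c N (\<Phi> N n) r = \<beta> N n * \<Phi> N n r" and \<beta>: "\<beta> N n \<noteq> 0"
    unfolding H_eigensystem_def H_eigenfunction_def by blast+
  have pos: "0 < exp 1 * c" using assms(2) by simp
  \<comment> \<open>For \<open>M = 0\<close> and \<open>p = -1\<close> the Gamma estimate would fail, as \<open>\<Gamma>(3/2) < 1\<close>; \<open>c > 0\<close> excludes this.\<close>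
  have "0 < real M" unfolding M_def using pos assms(4) by (rule less_le_trans)
  then have M: "M \<ge> 1" by simp
  have G: "G > 0" using p unfolding G_def by (intro Gamma_real_pos) linarith
  have s: "s > 0" using p by (simp add: s_def)
  have "c \<le> real M / exp 1" using assms(4) by (simp add: M_def field_simps)
  then have "c ^ M \<le> (real M / exp 1) ^ M" using assms(2) by (intro power_mono) auto
  then have "c ^ M * s \<le> (real M / exp 1) ^ M * s"
    using s by (intro mult_right_mono) auto
  also have "\<dots> < G" unfolding G_def s_def by (rule power_div_exp_less_Gamma[OF M p])
  finally have "c ^ M / G < 1 / s" using G s by (simp add: field_simps)
  then have less: "W * (c ^ M / G) < W * (1 / s)"
    by (rule mult_strict_left_mono) (simp add: W_def)
  define X where "X = \<bar>LINT r|radial_measure p. \<Phi> N n r * zernike_Rbar p N k r\<bar>"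
  have "\<bar>\<beta> N n\<bar> * X \<le> W * (c ^ M / G)"
    using eigenfunction_zernike_bound[OF p less_imp_le[OF assms(2)] eig, of k]
    unfolding X_def M_def W_def G_def times_divide_eq_right .
  also note less
  finally have "X < W * (1 / s) / \<bar>\<beta> N n\<bar>"
    using \<beta> by (simp add: pos_less_divide_eq mult.commute del: times_divide_eq_right)
  also have "1 / s = (real_of_int p + 2) powr (-1/2)"
    using p powr_minus[of "real_of_int p + 2" "1/2"] by (simp add: s_def powr_half_sqrt inverse_eq_divide)
  also have "W = (1/2) powr (real N + real_of_int p / 2 + 2 * real k + 1)"
    by (simp add: W_def M_def add_ac)
  finally show ?thesis by (simp only: X_def divide_inverse mult_ac)
qed

end
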